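(* Let $p=(12,R)$ be the mesh pattern with $R=\{(0,1),(0,2),(1,0),(1,1),(2,0),(2,2)\}$. Let $F(x)=\sum_{n\ge0}n!\,x^n$, $F(x,q)=\sum_{n\ge 0}x^n\sum_{\pi\in S_n}q^{p(\pi)}$, and $A(x)=\sum_{n\ge0}|S_n(p)|x^n$. Then, as formal power series in $x$, $$A(x)=F(x)-\frac{x^2F(x)^3}{1+xF(x)},\qquad F(x,q)=F(x)-\frac{(1-q)x^2F(x)^3}{1+x(1-q)F(x)}.$$
   Context: $S_n$ is the set of permutations $\pi=\pi_1\cdots\pi_n$ of $\{1,\dots,n\}$ ($S_0$ contains only the empty permutation). A mesh pattern $(12,R)$ consists of the permutation $12$ and a set $R\subseteq\{0,1,2\}\times\{0,1,2\}$ of shaded boxes. An occurrence of $(12,R)$ in $\pi\in S_n$ is a pair of positions $s<t$ with $\pi_s<\pi_t$ such that, putting $s_0=0,\ s_1=s,\ s_2=t,\ s_3=n+1$ and $v_0=0,\ v_1=\pi_s,\ v_2=\pi_t,\ v_3=n+1$, for every $(i,j)\in R$ there is no position $m$ with $s_i<m<s_{i+1}$ and $v_j<\pi_m<v_{j+1}$. $p(\pi)$ is the number of occurrences of $p$ in $\pi$, and $S_n(p)$ is the set of $\pi\in S_n$ with $p(\pi)=0$ (permutations avoiding $p$). *)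

theory Defs
  imports
    "HOL-Combinatorics.Permutations"
    "HOL-Computational_Algebra.Computational_Algebra"
begin

(* The cut points 0 = c_0 < c_1 = a < c_2 = b < c_3 = n + 1 of one axis; they serve both for
   positions (a, b = s, t) and for values (a, b = pi s, pi t). *)
definition grid_line :: "nat \<Rightarrow> nat \<Rightarrow> nat \<Rightarrow> nat \<Rightarrow> nat" where
  "grid_line n a b i = [0, a, b, n + 1] ! i"

(* A permutation in S_n is a function pi :: nat => nat with pi permutes {1..n}, so n has to be
   passed separately.  The set R is meant to be a subset of {0,1,2} x {0,1,2}. *)
definition mesh12_occurrences ::
    "(nat \<times> nat) set \<Rightarrow> nat \<Rightarrow> (nat \<Rightarrow> nat) \<Rightarrow> (nat \<times> nat) set" where
  "mesh12_occurrences R n \<pi> =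
     {(s, t). s \<in> {1..n} \<and> t \<in> {1..n} \<and> s < t \<and> \<pi> s < \<pi> t \<and>
        (\<forall>(i, j)\<in>R. \<not> (\<exists>m\<in>{1..n}.
            grid_line n s t i < m \<and> m < grid_line n s t (i + 1) \<and>
            grid_line n (\<pi> s) (\<pi> t) j < \<pi> m \<and> \<pi> m < grid_line n (\<pi> s) (\<pi> t) (j + 1)))}"

definition mesh12_count :: "(nat \<times> nat) set \<Rightarrow> nat \<Rightarrow> (nat \<Rightarrow> nat) \<Rightarrow> nat" where
  "mesh12_count R n \<pi> = card (mesh12_occurrences R n \<pi>)"

definition mesh12_avoiders :: "(nat \<times> nat) set \<Rightarrow> nat \<Rightarrow> (nat \<Rightarrow> nat) set" where
  "mesh12_avoiders R n = {\<pi>. \<pi> permutes {1..n} \<and> mesh12_count R n \<pi> = 0}"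

definition perm_gf :: "'a::semiring_char_0 fps" where
  "perm_gf = Abs_fps fact"

definition mesh12_avoid_gf :: "(nat \<times> nat) set \<Rightarrow> 'a::semiring_1 fps" where
  "mesh12_avoid_gf R = Abs_fps (\<lambda>n. of_nat (card (mesh12_avoiders R n)))"

definition mesh12_distr_gf :: "(nat \<times> nat) set \<Rightarrow> 'a::comm_semiring_1 \<Rightarrow> 'a fps" where
  "mesh12_distr_gf R q = Abs_fps (\<lambda>n. \<Sum>\<pi> | \<pi> permutes {1..n}. q ^ mesh12_count R n \<pi>)"

(* The formal variable q, as an element of the field Q(q) of rational functions.  The coefficients
   of F(x, q) lie in Q[q]; passing to Q(q) gives fps over a field, on which the library's division
   is the usual one. *)
definition q_indet :: "rat poly fract" where
  "q_indet = to_fract [:0, 1:]"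

end

theory Submission
  imports Defs
begin

text \<open>
  The six shaded boxes say that, in an occurrence \<open>(s, t)\<close>, everything left of \<open>s\<close> lies below
  \<open>\<pi> s\<close>, everything between \<open>s\<close> and \<open>t\<close> lies above \<open>\<pi> t\<close>, and everything right of \<open>t\<close> lies
  between \<open>\<pi> s\<close> and \<open>\<pi> t\<close>.  So \<open>\<pi>\<close> is the direct sum of some \<open>\<sigma>\<close>, a single point (at \<open>s\<close>) and
  some \<open>\<omega>\<close>, and \<open>t\<close> is a point of \<open>\<omega>\<close> that has only larger values before it and only smaller
  values after it (lemma \<open>mesh12_occurrences_eq_Sigma\<close>).  Such a \<open>t\<close> makes \<open>\<omega>\<close> indecomposable
  for the direct sum, hence \<open>s\<close> is the same for all occurrences in \<open>\<pi>\<close>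
  (lemma \<open>skew_points_nonempty_unique\<close>).

  Let \<open>G\<close> be the generating function of permutations by their number of strong fixed points, that
  is, of points with only smaller values before and only larger values after.  Reversing values
  turns the points \<open>t\<close> of \<open>\<omega>\<close> into strong fixed points, so
  \<open>F(x,q) - F\<close> is the sum over all \<open>\<sigma>\<close> and \<open>\<omega>\<close> of
  \<open>x^(|\<sigma>| + 1 + |\<omega>|) (q^k(\<omega>) - 1)\<close>, where \<open>k(\<omega>)\<close> is the number of points \<open>t\<close>,
  and this sum is \<open>x F (G - F)\<close>.
  To find \<open>G\<close>, expand \<open>q^k = 1 + (q - 1) (q^(k-1) + ... + 1)\<close>, one summand for each strong fixed
  point \<open>s\<close>, whose exponent counts the strong fixed points after \<open>s\<close>.  Those belong to the part
  of the permutation right of \<open>s\<close>, which gives \<open>G = F + (q - 1) x F G\<close>.  Solving for \<open>G\<close> yields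
  the formula for \<open>F(x,q)\<close>; the one for \<open>A(x)\<close> is its value at \<open>q = 0\<close>.
\<close>

section \<open>Strong fixed points and direct sums\<close>

text \<open>
  Permutations of every interval \<open>{a<..n}\<close> are considered, and not only of \<open>{1..n}\<close>, so that the
  part of a permutation after a strong fixed point is again of this kind without relabelling.
  The name is justified by lemma \<open>strong_fixed_point_fixed\<close>.
\<close>

definition strong_fixed_points :: "nat \<Rightarrow> nat \<Rightarrow> (nat \<Rightarrow> nat) \<Rightarrow> nat set" where
  "strong_fixed_points a n \<pi> =
     {s \<in> {a<..n}. \<forall>i\<in>{a<..n}. (i < s \<longrightarrow> \<pi> i < \<pi> s) \<and> (s < i \<longrightarrow> \<pi> s < \<pi> i)}"

definition skew_points :: "nat \<Rightarrow> nat \<Rightarrow> (nat \<Rightarrow> nat) \<Rightarrow> nat set" where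
  "skew_points a n \<pi> =
     {t \<in> {a<..n}. \<forall>i\<in>{a<..n}. (i < t \<longrightarrow> \<pi> t < \<pi> i) \<and> (t < i \<longrightarrow> \<pi> i < \<pi> t)}"

lemma finite_strong_fixed_points [simp]: "finite (strong_fixed_points a n \<pi>)"
  by (simp add: strong_fixed_points_def)

lemma finite_skew_points [simp]: "finite (skew_points a n \<pi>)"
  by (simp add: skew_points_def)

text \<open>
  By counting: the \<open>s - a - 1\<close> points before \<open>s\<close> have values in \<open>{a<..<\<pi> s}\<close>, and the \<open>n - s\<close>
  points after \<open>s\<close> have values in \<open>{\<pi> s<..n}\<close>.
\<close>

lemma strong_fixed_point_fixed:
  assumes \<pi>: "\<pi> permutes {a<..n}" and s: "s \<in> strong_fixed_points a n \<pi>"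
  shows "\<pi> s = s"
proof (rule antisym)
  have mem: "\<pi> i \<in> {a<..n}" if "i \<in> {a<..n}" for i
    using permutes_in_image[OF \<pi>] that by blast
  have inj: "inj_on \<pi> A" for A
    using permutes_inj[OF \<pi>] by (rule inj_on_subset) simp
  have s_mem: "s \<in> {a<..n}" using s by (simp add: strong_fixed_points_def)
  have "\<pi> ` {a<..<s} \<subseteq> {a<..<\<pi> s}"
    using s mem by (fastforce simp: strong_fixed_points_def)
  from card_mono[OF _ this] have "s - Suc a \<le> \<pi> s - Suc a"
    by (simp add: card_image[OF inj])
  then show "s \<le> \<pi> s" using s_mem mem[OF s_mem] by auto
  have "\<pi> ` {s<..n} \<subseteq> {\<pi> s<..n}"
    using s mem by (fastforce simp: strong_fixed_points_def)
  from card_mono[OF _ this] have "n - s \<le> n - \<pi> s"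
    by (simp add: card_image[OF inj])
  then show "\<pi> s \<le> s" using s_mem mem[OF s_mem] by auto
qed

lemma direct_sum_values:
  fixes \<sigma> \<omega> :: "nat \<Rightarrow> nat"
  assumes \<sigma>: "\<sigma> permutes {a<..<s}" and \<omega>: "\<omega> permutes {s<..n}"
  shows "i < s \<Longrightarrow> (\<sigma> \<circ> \<omega>) i = \<sigma> i" and "i < s \<Longrightarrow> \<sigma> i < s"
    and "(\<sigma> \<circ> \<omega>) s = s"
    and "s < i \<Longrightarrow> (\<sigma> \<circ> \<omega>) i = \<omega> i" and "s < i \<Longrightarrow> s < \<omega> i"
proof -
  show \<sigma>_less: "\<sigma> i < s" if "i < s"
    using permutes_in_image[OF \<sigma>, of i] permutes_not_in[OF \<sigma>, of i] that
    by (cases "i \<in> {a<..<s}") auto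
  show \<omega>_greater: "s < \<omega> i" if "s < i"
    using permutes_in_image[OF \<omega>, of i] permutes_not_in[OF \<omega>, of i] that
    by (cases "i \<in> {s<..n}") auto
  show "(\<sigma> \<circ> \<omega>) i = \<sigma> i" if "i < s"
    using permutes_not_in[OF \<omega>, of i] that by simp
  show "(\<sigma> \<circ> \<omega>) s = s"
    using permutes_not_in[OF \<omega>, of s] permutes_not_in[OF \<sigma>, of s] by simp
  show "(\<sigma> \<circ> \<omega>) i = \<omega> i" if "s < i"
    using permutes_not_in[OF \<sigma>, of "\<omega> i"] \<omega>_greater[OF that] by simp
qed

text \<open>
  A permutation with strong fixed point \<open>s\<close> splits into a permutation of the points before \<open>s\<close>
  and one of the points after \<open>s\<close>.  As both factors fix all points outside their intervals, the
  direct sum is their composition.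
\<close>

lemma bij_betw_direct_sum:
  assumes s: "s \<in> {a<..n}"
  shows "bij_betw (\<lambda>(\<sigma>, \<omega>). \<sigma> \<circ> \<omega>)
           ({\<sigma>. \<sigma> permutes {a<..<s}} \<times> {\<omega>. \<omega> permutes {s<..n}})
           {\<pi>. \<pi> permutes {a<..n} \<and> s \<in> strong_fixed_points a n \<pi>}"
    (is "bij_betw ?f (?S \<times> ?W) ?P")
proof (rule bij_betw_imageI)
  show "inj_on ?f (?S \<times> ?W)"
  proof (rule inj_onI, clarify, intro conjI)
    fix \<sigma> \<omega> \<sigma>' \<omega>'
    assume p: "\<sigma> permutes {a<..<s}" "\<omega> permutes {s<..n}"
      and p': "\<sigma>' permutes {a<..<s}" "\<omega>' permutes {s<..n}"
      and eq: "\<sigma> \<circ> \<omega> = \<sigma>' \<circ> \<omega>'"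
    show "\<sigma> = \<sigma>'"
    proof
      fix i show "\<sigma> i = \<sigma>' i"
        using direct_sum_values(1)[OF p, of i] direct_sum_values(1)[OF p', of i] eq
          permutes_not_in[OF p(1), of i] permutes_not_in[OF p'(1), of i]
        by (cases "i < s") auto
    qed
    show "\<omega> = \<omega>'"
    proof
      fix i show "\<omega> i = \<omega>' i"
        using direct_sum_values(4)[OF p, of i] direct_sum_values(4)[OF p', of i] eq
          permutes_not_in[OF p(2), of i] permutes_not_in[OF p'(2), of i]
        by (cases "s < i") auto
    qed
  qed
  show "?f ` (?S \<times> ?W) = ?P"
  proof (rule antisym; rule subsetI)
    fix \<pi> assume "\<pi> \<in> ?f ` (?S \<times> ?W)"
    then obtain \<sigma> \<omega> where p: "\<sigma> permutes {a<..<s}" "\<omega> permutes {s<..n}"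
      and \<pi>: "\<pi> = \<sigma> \<circ> \<omega>" by auto
    have "\<sigma> permutes {a<..n}" "\<omega> permutes {a<..n}"
      using s by (auto intro: permutes_subset[OF p(1)] permutes_subset[OF p(2)])
    then have "\<pi> permutes {a<..n}" unfolding \<pi> by (rule permutes_compose[rotated])
    moreover have "s \<in> strong_fixed_points a n \<pi>"
      using s direct_sum_values[OF p] unfolding \<pi> strong_fixed_points_def by auto
    ultimately show "\<pi> \<in> ?P" by simp
  next
    fix \<pi> assume "\<pi> \<in> ?P"
    then have \<pi>: "\<pi> permutes {a<..n}" and sfp: "s \<in> strong_fixed_points a n \<pi>" by auto
    note fixed = strong_fixed_point_fixed[OF \<pi> sfp]
    have below: "\<pi> i \<in> {a<..<s}" if "i \<in> {a<..<s}" for i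
      using sfp that fixed permutes_in_image[OF \<pi>, of i]
      by (auto simp: strong_fixed_points_def)
    have above: "\<pi> i \<in> {s<..n}" if "i \<in> {s<..n}" for i
      using sfp that fixed permutes_in_image[OF \<pi>, of i]
      by (auto simp: strong_fixed_points_def)
    define \<sigma> where "\<sigma> i = (if i \<in> {a<..<s} then \<pi> i else i)" for i
    define \<omega> where "\<omega> i = (if i \<in> {s<..n} then \<pi> i else i)" for i
    have inj: "inj_on \<pi> A" for A
      using permutes_inj[OF \<pi>] by (rule inj_on_subset) simp
    have "\<pi> ` {a<..<s} = {a<..<s}"
      by (rule endo_inj_surj[OF _ image_subsetI[OF below] inj]) simp
    then have "bij_betw \<pi> {a<..<s} {a<..<s}"
      unfolding bij_betw_def using inj by blast
    then have "bij_betw \<sigma> {a<..<s} {a<..<s}"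
      by (rule bij_betw_cong[THEN iffD1, rotated]) (simp add: \<sigma>_def)
    then have \<sigma>: "\<sigma> permutes {a<..<s}"
      by (rule bij_imp_permutes) (auto simp: \<sigma>_def)
    have "\<pi> ` {s<..n} = {s<..n}"
      by (rule endo_inj_surj[OF _ image_subsetI[OF above] inj]) simp
    then have "bij_betw \<pi> {s<..n} {s<..n}"
      unfolding bij_betw_def using inj by blast
    then have "bij_betw \<omega> {s<..n} {s<..n}"
      by (rule bij_betw_cong[THEN iffD1, rotated]) (simp add: \<omega>_def)
    then have \<omega>: "\<omega> permutes {s<..n}"
      by (rule bij_imp_permutes) (auto simp: \<omega>_def)
    have "\<pi> = \<sigma> \<circ> \<omega>"
    proof
      fix i
      consider "i < s" | "i = s" | "s < i" by linarith
      then show "\<pi> i = (\<sigma> \<circ> \<omega>) i"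
      proof cases
        case 1
        then show ?thesis
          using direct_sum_values(1)[OF \<sigma> \<omega>] permutes_not_in[OF \<pi>, of i] s
          by (auto simp: \<sigma>_def)
      next
        case 2
        then show ?thesis using direct_sum_values(3)[OF \<sigma> \<omega>] fixed by simp
      next
        case 3
        then show ?thesis
          using direct_sum_values(4)[OF \<sigma> \<omega>] permutes_not_in[OF \<pi>, of i] s
          by (auto simp: \<omega>_def)
      qed
    qed
    with \<sigma> \<omega> show "\<pi> \<in> ?f ` (?S \<times> ?W)" by force
  qed
qed

text \<open>
  Both generating function identities sum, over all pairs of a permutation and one of its strong
  fixed points, a weight that sees only the part after that point; the part before it contributes
  a factorial.
\<close>

lemma sum_over_strong_fixed_points:
  fixes f g :: "nat \<Rightarrow> (nat \<Rightarrow> nat) \<Rightarrow> 'a :: {comm_semiring_1, semiring_char_0}"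
  assumes fg: "\<And>s \<sigma> \<omega>. s \<in> {a<..n} \<Longrightarrow> \<sigma> permutes {a<..<s} \<Longrightarrow> \<omega> permutes {s<..n} \<Longrightarrow>
                 f s (\<sigma> \<circ> \<omega>) = g s \<omega>"
  shows "(\<Sum>\<pi> | \<pi> permutes {a<..n}. \<Sum>s\<in>strong_fixed_points a n \<pi>. f s \<pi>) =
         (\<Sum>s\<in>{a<..n}. fact (s - Suc a) * (\<Sum>\<omega> | \<omega> permutes {s<..n}. g s \<omega>))"
proof -
  let ?P = "{\<pi>. \<pi> permutes {a<..n}}"
  have "(\<Sum>\<pi>\<in>?P. \<Sum>s\<in>strong_fixed_points a n \<pi>. f s \<pi>) =
        (\<Sum>\<pi>\<in>?P. \<Sum>s\<in>{s \<in> {a<..n}. s \<in> strong_fixed_points a n \<pi>}. f s \<pi>)"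
    by (intro sum.cong refl) (auto simp: strong_fixed_points_def)
  also have "\<dots> = (\<Sum>s\<in>{a<..n}. \<Sum>\<pi>\<in>{\<pi> \<in> ?P. s \<in> strong_fixed_points a n \<pi>}. f s \<pi>)"
    by (rule sum.swap_restrict) (simp_all add: finite_permutations)
  also have "\<dots> = (\<Sum>s\<in>{a<..n}. fact (s - Suc a) * (\<Sum>\<omega> | \<omega> permutes {s<..n}. g s \<omega>))"
  proof (rule sum.cong[OF refl])
    fix s assume s: "s \<in> {a<..n}"
    let ?SW = "{\<sigma>. \<sigma> permutes {a<..<s}} \<times> {\<omega>. \<omega> permutes {s<..n}}"
    have "(\<Sum>\<pi>\<in>{\<pi> \<in> ?P. s \<in> strong_fixed_points a n \<pi>}. f s \<pi>) =
          (\<Sum>x\<in>?SW. f s ((\<lambda>(\<sigma>, \<omega>). \<sigma> \<circ> \<omega>) x))"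
      using sum.reindex_bij_betw[OF bij_betw_direct_sum[OF s], of "f s"] by simp
    also have "\<dots> = (\<Sum>x\<in>?SW. g s (snd x))"
      by (rule sum.cong) (auto simp: fg[OF s])
    also have "\<dots> = (\<Sum>\<sigma> | \<sigma> permutes {a<..<s}. \<Sum>\<omega> | \<omega> permutes {s<..n}. g s \<omega>)"
      by (simp only: sum.cartesian_product split_def)
    also have "\<dots> = fact (s - Suc a) * (\<Sum>\<omega> | \<omega> permutes {s<..n}. g s \<omega>)"
      by (simp add: card_permutations[OF refl])
    finally show "(\<Sum>\<pi>\<in>{\<pi> \<in> ?P. s \<in> strong_fixed_points a n \<pi>}. f s \<pi>) =
                  fact (s - Suc a) * (\<Sum>\<omega> | \<omega> permutes {s<..n}. g s \<omega>)" .
  qed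
  finally show ?thesis .
qed

section \<open>The distribution of strong fixed points\<close>

text \<open>A geometric sum: the exponents on the right run through \<open>0, ..., card S - 1\<close>.\<close>

lemma power_card_eq_sum_power_card_greater:
  fixes q :: "'a :: comm_ring_1" and S :: "'b :: linorder set"
  assumes "finite S"
  shows "q ^ card S = 1 + (q - 1) * (\<Sum>s\<in>S. q ^ card {t \<in> S. s < t})"
  using assms
proof (induction S rule: finite_linorder_min_induct)
  case empty
  then show ?case by simp
next
  case (insert b A)
  have b: "b \<notin> A" using insert by blast
  have "{t \<in> insert b A. b < t} = A" using insert by auto
  moreover have "(\<Sum>s\<in>A. q ^ card {t \<in> insert b A. s < t}) = (\<Sum>s\<in>A. q ^ card {t \<in> A. s < t})"
    using insert by (intro sum.cong refl arg_cong[of _ _ "\<lambda>X. q ^ card X"]) auto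
  ultimately have "(\<Sum>s\<in>insert b A. q ^ card {t \<in> insert b A. s < t}) =
      q ^ card A + (\<Sum>s\<in>A. q ^ card {t \<in> A. s < t})"
    by (simp only: sum.insert[OF insert.hyps(1) b])
  then have "1 + (q - 1) * (\<Sum>s\<in>insert b A. q ^ card {t \<in> insert b A. s < t}) =
      (q - 1) * q ^ card A + (1 + (q - 1) * (\<Sum>s\<in>A. q ^ card {t \<in> A. s < t}))"
    by (simp only: distrib_left add_ac)
  also have "\<dots> = (q - 1) * q ^ card A + q ^ card A"
    by (simp only: insert.IH)
  also have "\<dots> = q ^ card (insert b A)"
    using insert.hyps(1) b by (simp add: algebra_simps)
  finally show ?case by (rule sym)
qed

lemma strong_fixed_points_direct_sum_greater:
  assumes s: "s \<in> {a<..n}" and p: "\<sigma> permutes {a<..<s}" "\<omega> permutes {s<..n}"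
  shows "{t \<in> strong_fixed_points a n (\<sigma> \<circ> \<omega>). s < t} = strong_fixed_points s n \<omega>"
proof -
  have below: "(\<sigma> \<circ> \<omega>) i < (\<sigma> \<circ> \<omega>) t" if "i \<le> s" "s < t" for i t
    using direct_sum_values[OF p] that by (metis le_neq_implies_less less_trans)
  have "t \<in> strong_fixed_points a n (\<sigma> \<circ> \<omega>) \<longleftrightarrow> t \<in> strong_fixed_points s n \<omega>" if t: "s < t" for t
  proof -
    have "{a<..n} = {a<..s} \<union> {s<..n}" using s by auto
    then have "t \<in> strong_fixed_points a n (\<sigma> \<circ> \<omega>) \<longleftrightarrow> t \<in> strong_fixed_points s n (\<sigma> \<circ> \<omega>)"
      using t s below by (auto simp: strong_fixed_points_def simp del: comp_apply)
    also have "\<dots> \<longleftrightarrow> t \<in> strong_fixed_points s n \<omega>"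
      using direct_sum_values(4)[OF p] t
      by (auto simp: strong_fixed_points_def simp del: comp_apply)
    finally show ?thesis .
  qed
  moreover have "s < t" if "t \<in> strong_fixed_points s n \<omega>" for t
    using that by (simp add: strong_fixed_points_def)
  ultimately show ?thesis by blast
qed

definition strong_fixed_point_sum :: "'a :: comm_semiring_1 \<Rightarrow> nat \<Rightarrow> nat \<Rightarrow> 'a" where
  "strong_fixed_point_sum q a n =
     (\<Sum>\<pi> | \<pi> permutes {a<..n}. q ^ card (strong_fixed_points a n \<pi>))"

lemma strong_fixed_point_sum_rec:
  fixes q :: "'a :: {comm_ring_1, semiring_char_0}"
  shows "strong_fixed_point_sum q a n =
     fact (n - a) + (q - 1) * (\<Sum>s\<in>{a<..n}. fact (s - Suc a) * strong_fixed_point_sum q s n)"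
proof -
  let ?P = "{\<pi>. \<pi> permutes {a<..n}}"
  have "strong_fixed_point_sum q a n =
    (\<Sum>\<pi>\<in>?P. 1 + (q - 1) *
      (\<Sum>s\<in>strong_fixed_points a n \<pi>. q ^ card {t \<in> strong_fixed_points a n \<pi>. s < t}))"
    unfolding strong_fixed_point_sum_def
    by (intro sum.cong refl power_card_eq_sum_power_card_greater) simp
  also have "\<dots> = of_nat (card ?P) + (q - 1) *
    (\<Sum>\<pi>\<in>?P. \<Sum>s\<in>strong_fixed_points a n \<pi>. q ^ card {t \<in> strong_fixed_points a n \<pi>. s < t})"
    by (simp add: sum.distrib sum_distrib_left)
  also have "(\<Sum>\<pi>\<in>?P. \<Sum>s\<in>strong_fixed_points a n \<pi>.
                q ^ card {t \<in> strong_fixed_points a n \<pi>. s < t}) =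
    (\<Sum>s\<in>{a<..n}. fact (s - Suc a) * strong_fixed_point_sum q s n)"
    unfolding strong_fixed_point_sum_def
    by (rule sum_over_strong_fixed_points) (simp add: strong_fixed_points_direct_sum_greater)
  finally show ?thesis by (simp add: card_permutations[OF refl])
qed

text \<open>
  Splitting the interval \<open>{a<..n}\<close> at a point \<open>s\<close> leaves lengths that add up to \<open>n - a - 1\<close>; hence
  the convolution and the factor \<open>x\<close>.
\<close>

lemma fps_nth_X_mult_mult:
  fixes A B :: "'a :: comm_semiring_1 fps"
  shows "(fps_X * A * B) $ (n - a) = (\<Sum>s\<in>{a<..n}. A $ (s - Suc a) * B $ (n - s))"
proof (cases "a < n")
  case False
  then show ?thesis by (simp add: mult.assoc)
next
  case True
  then obtain k where k: "n = Suc (a + k)" using less_imp_Suc_add by blast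
  have "n - a = Suc k" by (simp add: k)
  then have "(fps_X * A * B) $ (n - a) = (A * B) $ k" by (simp add: mult.assoc)
  also have "\<dots> = (\<Sum>i=0..k. A $ i * B $ (k - i))" by (rule fps_mult_nth)
  also have "\<dots> = (\<Sum>s\<in>{a<..n}. A $ (s - Suc a) * B $ (n - s))"
    by (rule sum.reindex_bij_witness[of _ "\<lambda>s. s - Suc a" "\<lambda>i. i + Suc a"]) (auto simp: k)
  finally show ?thesis .
qed

definition strong_fixed_point_gf :: "'a :: {field, semiring_char_0} \<Rightarrow> 'a fps" where
  "strong_fixed_point_gf q = perm_gf / (1 + fps_X * fps_const (1 - q) * perm_gf)"

lemma strong_fixed_point_gf_mult_denominator:
  "(1 + fps_X * fps_const (1 - q) * perm_gf) * strong_fixed_point_gf q = perm_gf"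
proof -
  have "(1 + fps_X * fps_const (1 - q) * perm_gf) $ 0 \<noteq> 0"
    by (simp add: mult.assoc)
  then have "is_unit (1 + fps_X * fps_const (1 - q) * perm_gf)"
    by (simp add: fps_is_unit_iff)
  then show ?thesis
    unfolding strong_fixed_point_gf_def by simp
qed

lemma strong_fixed_point_gf_rec:
  "strong_fixed_point_gf q =
     perm_gf + fps_const (q - 1) * (fps_X * perm_gf * strong_fixed_point_gf q)"
proof -
  have minus: "fps_const (q - 1) = - fps_const (1 - q)"
    by simp
  show ?thesis
    unfolding minus using strong_fixed_point_gf_mult_denominator[of q]
    by (simp add: algebra_simps del: fps_const_neg)
qed

lemma strong_fixed_point_sum_eq_gf_nth:
  fixes q :: "'a :: {field, semiring_char_0}"
  shows "strong_fixed_point_sum q a n = strong_fixed_point_gf q $ (n - a)"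
proof (induction "n - a" arbitrary: a rule: less_induct)
  case less
  have "(\<Sum>s\<in>{a<..n}. fact (s - Suc a) * strong_fixed_point_sum q s n) =
        (\<Sum>s\<in>{a<..n}. fact (s - Suc a) * strong_fixed_point_gf q $ (n - s))"
    by (intro sum.cong refl arg_cong2[of _ _ _ _ times] less) auto
  then have "strong_fixed_point_sum q a n =
     fact (n - a) + (q - 1) * (\<Sum>s\<in>{a<..n}. fact (s - Suc a) * strong_fixed_point_gf q $ (n - s))"
    by (simp add: strong_fixed_point_sum_rec[of q a n])
  also have "\<dots> = (perm_gf + fps_const (q - 1) * (fps_X * perm_gf * strong_fixed_point_gf q)) $ (n - a)"
    by (simp add: fps_nth_X_mult_mult perm_gf_def del: fps_const_sub)
  also have "\<dots> = strong_fixed_point_gf q $ (n - a)"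
    using strong_fixed_point_gf_rec[of q] by simp
  finally show ?case .
qed

section \<open>Occurrences of the mesh pattern\<close>

lemma mesh12_occurrences_eq_Sigma:
  assumes R: "R = {(0,1), (0,2), (1,0), (1,1), (2,0), (2,2)}" and \<pi>: "\<pi> permutes {1..n}"
  shows "mesh12_occurrences R n \<pi> = Sigma (strong_fixed_points 0 n \<pi>) (\<lambda>s. skew_points s n \<pi>)"
proof -
  have val: "0 < \<pi> i \<and> \<pi> i < Suc n" if "0 < i" "i \<le> n" for i
    using permutes_in_image[OF \<pi>, of i] that by auto
  have neq: "\<pi> i \<noteq> \<pi> j" if "i \<noteq> j" for i j
    using permutes_inj[OF \<pi>] that by (auto dest: injD)
  have "(s, t) \<in> mesh12_occurrences R n \<pi> \<longleftrightarrow>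
        s \<in> strong_fixed_points 0 n \<pi> \<and> t \<in> skew_points s n \<pi>" for s t
  proof
    assume occ: "(s, t) \<in> mesh12_occurrences R n \<pi>"
    then have st: "0 < s" "s < t" "t \<le> n" "\<pi> s < \<pi> t"
      by (auto simp: mesh12_occurrences_def)
    have boxes: "\<not> (m < s \<and> \<pi> s < \<pi> m \<and> \<pi> m < \<pi> t)" "\<not> (m < s \<and> \<pi> t < \<pi> m)"
      "\<not> (s < m \<and> m < t \<and> \<pi> m < \<pi> s)" "\<not> (s < m \<and> m < t \<and> \<pi> s < \<pi> m \<and> \<pi> m < \<pi> t)"
      "\<not> (t < m \<and> \<pi> m < \<pi> s)" "\<not> (t < m \<and> \<pi> t < \<pi> m)"
      if "0 < m" "m \<le> n" for m
      using occ that val[OF that]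
      by (auto simp: mesh12_occurrences_def R grid_line_def numeral_eq_Suc)
    have before: "\<pi> m < \<pi> s" if "0 < m" "m < s" for m
      using boxes(1,2)[of m] neq[of m s] neq[of m t] that st by linarith
    have between: "\<pi> t < \<pi> m" if "s < m" "m < t" for m
      using boxes(3,4)[of m] neq[of m s] neq[of m t] that st by linarith
    have after: "\<pi> s < \<pi> m \<and> \<pi> m < \<pi> t" if "t < m" "m \<le> n" for m
      using boxes(5,6)[of m] neq[of m s] neq[of m t] that st by linarith
    have right: "\<pi> s < \<pi> m" if "s < m" "m \<le> n" for m
      using between[of m] after[of m] that st by (cases m t rule: linorder_cases) auto
    show "s \<in> strong_fixed_points 0 n \<pi> \<and> t \<in> skew_points s n \<pi>"
      using before between after right st
      by (auto simp: strong_fixed_points_def skew_points_def)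
  next
    assume st: "s \<in> strong_fixed_points 0 n \<pi> \<and> t \<in> skew_points s n \<pi>"
    then have mem: "0 < s" "s < t" "t \<le> n" and less: "\<pi> s < \<pi> t"
      by (auto simp: strong_fixed_points_def skew_points_def)
    have before: "\<pi> m < \<pi> s" if "m < s" "Suc 0 \<le> m" for m
      using st that by (auto simp: strong_fixed_points_def)
    have between: "\<pi> t < \<pi> m" if "s < m" "m < t" for m
      using st that by (auto simp: skew_points_def)
    have after: "\<pi> s < \<pi> m \<and> \<pi> m < \<pi> t" if "t < m" "m \<le> n" for m
      using st that mem by (auto simp: strong_fixed_points_def skew_points_def)
    show "(s, t) \<in> mesh12_occurrences R n \<pi>"
      using mem less
      by (auto simp: mesh12_occurrences_def R grid_line_def numeral_eq_Suc
          dest: before between after)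
  qed
  then show ?thesis by auto
qed

text \<open>
  Let \<open>s < s'\<close> and let \<open>t\<close>, \<open>t'\<close> be skew points after \<open>s\<close> and \<open>s'\<close>.  If \<open>t \<noteq> s'\<close>, then the points at
  \<open>t\<close> and \<open>s'\<close> are in increasing order because \<open>s'\<close> is a strong fixed point, and in decreasing order
  because \<open>t\<close> is a skew point.  If \<open>t = s'\<close>, the same contradiction arises for \<open>t\<close> and \<open>t'\<close>.
\<close>

lemma skew_points_nonempty_unique:
  assumes "s \<in> strong_fixed_points a n \<pi>" "skew_points s n \<pi> \<noteq> {}"
    and "s' \<in> strong_fixed_points a n \<pi>" "skew_points s' n \<pi> \<noteq> {}"
  shows "s = s'"
proof -
  have "\<not> s < s'" if s: "s \<in> strong_fixed_points a n \<pi>" "t \<in> skew_points s n \<pi>"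
    and s': "s' \<in> strong_fixed_points a n \<pi>" "t' \<in> skew_points s' n \<pi>" for s s' t t'
  proof
    assume less: "s < s'"
    have mem: "a < s" "s < t" "t \<le> n" "s' < t'" "t' \<le> n"
      using s s' by (auto simp: strong_fixed_points_def skew_points_def)
    have fixed: "i < s' \<Longrightarrow> \<pi> i < \<pi> s'" "s' < i \<Longrightarrow> \<pi> s' < \<pi> i" if "a < i" "i \<le> n" for i
      using s'(1) that by (auto simp: strong_fixed_points_def)
    have skew: "i < t \<Longrightarrow> \<pi> t < \<pi> i" "t < i \<Longrightarrow> \<pi> i < \<pi> t" if "s < i" "i \<le> n" for i
      using s(2) that by (auto simp: skew_points_def)
    show False
      using fixed[of t] fixed[of t'] skew[of s'] skew[of t'] mem less
      by (cases t s' rule: linorder_cases) auto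
  qed
  with assms show ?thesis by (metis ex_in_conv linorder_neqE_nat)
qed

text \<open>
  At most one summand on the right is non-zero, since the first coordinate of an occurrence is
  unique.  Subtracting 1 is what makes the empty summands vanish, so that the count can be
  distributed over all strong fixed points.
\<close>

lemma power_mesh12_count_minus_1:
  fixes q :: "'a :: comm_ring_1"
  assumes R: "R = {(0,1), (0,2), (1,0), (1,1), (2,0), (2,2)}" and \<pi>: "\<pi> permutes {1..n}"
  shows "q ^ mesh12_count R n \<pi> - 1 =
         (\<Sum>s\<in>strong_fixed_points 0 n \<pi>. q ^ card (skew_points s n \<pi>) - 1)"
proof -
  let ?S = "strong_fixed_points 0 n \<pi>"
  have count: "mesh12_count R n \<pi> = (\<Sum>s\<in>?S. card (skew_points s n \<pi>))"
    by (simp add: mesh12_count_def mesh12_occurrences_eq_Sigma[OF R \<pi>])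
  show ?thesis
  proof (cases "\<exists>s\<in>?S. skew_points s n \<pi> \<noteq> {}")
    case False
    then show ?thesis by (simp add: count)
  next
    case True
    then obtain s where s: "s \<in> ?S" "skew_points s n \<pi> \<noteq> {}" by blast
    have others: "skew_points s' n \<pi> = {}" if "s' \<in> ?S - {s}" for s'
      using skew_points_nonempty_unique[OF s] that by blast
    have "mesh12_count R n \<pi> = card (skew_points s n \<pi>)"
      unfolding count using s others by (simp add: sum.remove[of _ s])
    moreover have "(\<Sum>s\<in>?S. q ^ card (skew_points s n \<pi>) - 1) = q ^ card (skew_points s n \<pi>) - 1"
      using s others by (simp add: sum.remove[of _ s])
    ultimately show ?thesis by simp
  qed
qed

text \<open>Reversing all values exchanges skew points and strong fixed points.\<close>

lemma sum_power_card_skew_points: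
  fixes q :: "'a :: comm_semiring_1"
  shows "(\<Sum>\<omega> | \<omega> permutes {a<..n}. q ^ card (skew_points a n \<omega>)) = strong_fixed_point_sum q a n"
proof -
  define r where "r i = (if i \<in> {a<..n} then Suc (a + n) - i else i)" for i
  have "bij_betw r {a<..n} {a<..n}"
    by (rule bij_betwI[where g = r]) (auto simp: r_def)
  then have r: "r permutes {a<..n}"
    by (rule bij_imp_permutes) (auto simp: r_def)
  have r_less: "r i < r j \<longleftrightarrow> j < i" if "i \<in> {a<..n}" "j \<in> {a<..n}" for i j
    using that by (auto simp: r_def)
  have skew: "skew_points a n \<omega> = strong_fixed_points a n (r \<circ> \<omega>)" if \<omega>: "\<omega> permutes {a<..n}" for \<omega>
  proof -
    have "\<omega> i \<in> {a<..n}" if "i \<in> {a<..n}" for i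
      using permutes_in_image[OF \<omega>] that by blast
    then show ?thesis
      unfolding skew_points_def strong_fixed_points_def by (auto simp: r_less)
  qed
  have "strong_fixed_point_sum q a n =
        (\<Sum>\<omega> | \<omega> permutes {a<..n}. q ^ card (strong_fixed_points a n (r \<circ> \<omega>)))"
    unfolding strong_fixed_point_sum_def by (rule setum_permutations_compose_left[OF r])
  then show ?thesis by (simp add: skew)
qed

section \<open>The generating functions\<close>

lemma mesh12_distr_gf_eq_strong_fixed_point_gf:
  fixes q :: "'a :: {field, semiring_char_0}"
  assumes R: "R = {(0,1), (0,2), (1,0), (1,1), (2,0), (2,2)}"
  shows "mesh12_distr_gf R q = perm_gf + fps_X * perm_gf * (strong_fixed_point_gf q - perm_gf)"
proof (rule fps_ext)
  fix n :: nat
  have interval: "{Suc 0..n} = {0<..n}" by auto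
  let ?P = "{\<pi>. \<pi> permutes {0<..n}}"
  have weight: "skew_points s n (\<sigma> \<circ> \<omega>) = skew_points s n \<omega>"
    if "\<sigma> permutes {0<..<s}" "\<omega> permutes {s<..n}" for s \<sigma> \<omega>
    using direct_sum_values(4)[OF that] unfolding skew_points_def by auto
  have "mesh12_distr_gf R q $ n - fact n = (\<Sum>\<pi>\<in>?P. q ^ mesh12_count R n \<pi> - 1)"
    by (simp add: mesh12_distr_gf_def interval sum_subtractf card_permutations[OF refl])
  also have "\<dots> = (\<Sum>\<pi>\<in>?P. \<Sum>s\<in>strong_fixed_points 0 n \<pi>. q ^ card (skew_points s n \<pi>) - 1)"
    by (rule sum.cong) (simp_all add: power_mesh12_count_minus_1[OF R] interval)
  also have "\<dots> = (\<Sum>s\<in>{0<..n}. fact (s - Suc 0) *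
                   (\<Sum>\<omega> | \<omega> permutes {s<..n}. q ^ card (skew_points s n \<omega>) - 1))"
    by (rule sum_over_strong_fixed_points) (simp add: weight)
  also have "\<dots> = (\<Sum>s\<in>{0<..n}. perm_gf $ (s - Suc 0) * (strong_fixed_point_gf q - perm_gf) $ (n - s))"
    by (simp add: sum_subtractf sum_power_card_skew_points strong_fixed_point_sum_eq_gf_nth
        card_permutations[OF refl] perm_gf_def)
  also have "\<dots> = (fps_X * perm_gf * (strong_fixed_point_gf q - perm_gf)) $ (n - 0)"
    by (rule fps_nth_X_mult_mult[symmetric])
  finally show "mesh12_distr_gf R q $ n =
      (perm_gf + fps_X * perm_gf * (strong_fixed_point_gf q - perm_gf)) $ n"
    by (simp add: perm_gf_def algebra_simps)
qed

lemma mesh12_distr_gf_closed_form: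
  fixes q :: "'a :: {field, semiring_char_0}"
  assumes R: "R = {(0,1), (0,2), (1,0), (1,1), (2,0), (2,2)}"
  shows "mesh12_distr_gf R q =
           perm_gf - fps_const (1 - q) * fps_X^2 * perm_gf^3
                     / (1 + fps_X * fps_const (1 - q) * perm_gf)"
proof -
  let ?D = "1 + fps_X * fps_const (1 - q) * perm_gf :: 'a fps"
  let ?G = "strong_fixed_point_gf q"
  have "?D $ 0 \<noteq> 0" by (simp add: mult.assoc)
  then have D: "?D \<noteq> 0" by (metis fps_zero_nth)
  have "fps_const (1 - q) * fps_X^2 * perm_gf^3 =
        ?D * (fps_const (1 - q) * fps_X^2 * perm_gf^2 * ?G)"
    using strong_fixed_point_gf_mult_denominator[of q]
    by (simp add: power2_eq_square power3_eq_cube mult_ac)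
  then have quotient: "fps_const (1 - q) * fps_X^2 * perm_gf^3 / ?D =
                       fps_const (1 - q) * fps_X^2 * perm_gf^2 * ?G"
    by (simp only: nonzero_mult_div_cancel_left[OF D])
  have "?G - perm_gf = - fps_const (1 - q) * (fps_X * perm_gf * ?G)"
    using strong_fixed_point_gf_mult_denominator[of q]
    by (simp add: algebra_simps del: fps_const_neg)
  then show ?thesis
    unfolding mesh12_distr_gf_eq_strong_fixed_point_gf[OF R] quotient
    by (simp add: power2_eq_square mult_ac del: fps_const_neg)
qed

lemma mesh12_avoid_gf_eq_distr_gf_0:
  "(mesh12_avoid_gf R :: 'a :: comm_semiring_1 fps) = mesh12_distr_gf R 0"
proof (rule fps_ext)
  fix n
  have "(\<Sum>\<pi> | \<pi> permutes {1..n}. 0 ^ mesh12_count R n \<pi> :: 'a) =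
        (\<Sum>\<pi> | \<pi> permutes {1..n} \<and> mesh12_count R n \<pi> = 0. 1)"
    by (rule sum.mono_neutral_cong_right) (auto simp: finite_permutations power_0_left)
  then show "(mesh12_avoid_gf R :: 'a fps) $ n = mesh12_distr_gf R 0 $ n"
    by (simp add: mesh12_avoid_gf_def mesh12_distr_gf_def mesh12_avoiders_def)
qed

theorem theorem3p3:
  fixes R :: "(nat \<times> nat) set"
  assumes R: "R = {(0,1), (0,2), (1,0), (1,1), (2,0), (2,2)}"
  shows "(mesh12_avoid_gf R :: rat fps) =
           perm_gf - fps_X^2 * perm_gf^3 / (1 + fps_X * perm_gf)
       \<and>
         mesh12_distr_gf R q_indet =
           perm_gf - fps_const (1 - q_indet) * fps_X^2 * perm_gf^3
                     / (1 + fps_X * fps_const (1 - q_indet) * perm_gf)"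
proof
  show "(mesh12_avoid_gf R :: rat fps) =
          perm_gf - fps_X^2 * perm_gf^3 / (1 + fps_X * perm_gf)"
    using mesh12_distr_gf_closed_form[OF R, of "0 :: rat"]
    by (simp add: mesh12_avoid_gf_eq_distr_gf_0)
qed (rule mesh12_distr_gf_closed_form[OF R])

end
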